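(* Given any $\varepsilon>0$ and $0<\vartheta\leqslant\min(0.09,1/m)$, let $$\psi(\alpha,\vartheta)=\frac12\vartheta^2-\alpha\vartheta\ln\frac{m}{\alpha\vartheta},$$ $$C_1=\frac{m-1}{\psi(\alpha,\vartheta)},\qquad C_2=\frac{m\ln 0.6+(0.5\ln 2\pi+1/12-0.5\ln m)\,m+\ln\left(\frac{1/\varepsilon+1}{0.249}\right)}{\psi(\alpha,\vartheta)},$$ $$N(\alpha)=\begin{cases}1.5\,C_1\ln(C_1+C_2)+C_2,&\text{if }C_2>0\text{ and }C_1+C_2\geqslant 21,\\ 1.5\,C_1\ln C_1+C_2,&\text{if }C_2\leqslant 0,\end{cases}$$ for those $\alpha\in(0,1)$ with $\psi(\alpha,\vartheta)>0$, and let $\hat\alpha\in(0,1)$ be the solution of the equation $$N(\alpha)=\frac{3m}{4\alpha\vartheta}.$$ Let $u^{\ast}\in P_n$ be the rational probability distribution obtained from the uniform vector $(1/m,\dots,1/m)$ by the rounding and adjusting procedure described in the context. Then for any $n\geqslant N(\hat\alpha)$, $$\frac{\#u^{\ast}}{\#\{p\in P_n:\ \|p-(1/m,\dots,1/m)\|_1>\vartheta\}}>\frac1\varepsilon\qquad\text{and}\qquad\|u^{\ast}-(1/m,\dots,1/m)\|_1\leqslant\hat\alpha\vartheta .$$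
   Context: Fix a positive integer $m$. For $n\in\mathbb{N}$, $P_n=\{(\nu_1/n,\dots,\nu_m/n):\nu_i\in\mathbb{Z}_{\geqslant 0},\ \nu_1+\dots+\nu_m=n\}$, viewed as a set of discrete probability distributions. For $p\in P_n$, $\#p=n!/\prod_i(np_i)!$ is its number of realizations; for a set $S\subseteq P_n$, $\#S=\sum_{p\in S}\#p$. An inequality $\#u^{\ast}/\#S>1/\varepsilon$ is understood as $\varepsilon\,\#u^{\ast}>\#S$ (so it holds if $S=\emptyset$). Rounding and adjusting: for a probability vector $\varphi\in\mathbb{R}^m$ and $n\geqslant m$, let $\tilde\nu$ be obtained from $n\varphi$ by rounding each entry to a nearest integer, and let $d=\sum_i\tilde\nu_i-n$. If $d=0$ let $\nu^{\ast}=\tilde\nu$; if $d<0$ add $1$ to $|d|$ entries of $\tilde\nu$ that were rounded down; if $d>0$ subtract $1$ from $|d|$ entries that were rounded up. The resulting vector is $\nu^{\ast}$, and the rational distribution obtained is $\nu^{\ast}/n\in P_n$; here $\varphi=(1/m,\dots,1/m)$ and $u^{\ast}=\nu^{\ast}/n$. The case $C_2>0$, $C_1+C_2<21$ is not covered by the definition of $N(\alpha)$ and is assumed not to occur. *)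

theory Defs
  imports "HOL-Analysis.Analysis"
begin

(* The positive integer m is CARD('m); vectors of R^m are elements of real^'m. *)

definition norm1 :: "real ^ 'm \<Rightarrow> real" where
  "norm1 x = (\<Sum>i\<in>UNIV. \<bar>x $ i\<bar>)"

definition uniform :: "real ^ 'm" where
  "uniform = (\<chi> i. 1 / real CARD('m))"

definition P :: "nat \<Rightarrow> (real ^ 'm) set" where
  "P n = {(\<chi> i. real (\<nu> $ i) / real n) | \<nu> :: nat ^ 'm. (\<Sum>i\<in>UNIV. \<nu> $ i) = n}"

lemma finite_P: "finite (P n :: (real ^ 'm) set)"
proof -
  have "finite {\<nu> :: nat ^ 'm. (\<Sum>i\<in>UNIV. \<nu> $ i) = n}"
  proof (rule finite_subset)
    show "{\<nu> :: nat ^ 'm. (\<Sum>i\<in>UNIV. \<nu> $ i) = n} \<subseteq> vec_lambda ` (PiE UNIV (\<lambda>_. {..n}))"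
    proof
      fix \<nu> :: "nat ^ 'm" assume a: "\<nu> \<in> {\<nu>. (\<Sum>i\<in>UNIV. \<nu> $ i) = n}"
      have "\<nu> $ i \<le> n" for i
        using a member_le_sum[of i UNIV "\<lambda>i. \<nu> $ i"] by auto
      then show "\<nu> \<in> vec_lambda ` (PiE UNIV (\<lambda>_. {..n}))"
        by (intro image_eqI[of _ _ "vec_nth \<nu>"]) auto
    qed
  qed (auto intro!: finite_imageI finite_PiE)
  moreover have "P n = (\<lambda>\<nu>::nat^'m. \<chi> i. real (\<nu> $ i) / real n) ` {\<nu>. (\<Sum>i\<in>UNIV. \<nu> $ i) = n}"
    unfolding P_def by auto
  ultimately show ?thesis by simp
qed

(* For p in P n with n > 0 the numbers n * p_i are natural numbers, so the floor only
   converts the type. The argument n is needed since the sets P n overlap. *)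
definition realizations :: "nat \<Rightarrow> real ^ 'm \<Rightarrow> real" where
  "realizations n p = fact n / (\<Prod>i\<in>UNIV. fact (nat \<lfloor>real n * p $ i\<rfloor>))"

definition set_realizations :: "nat \<Rightarrow> (real ^ 'm) set \<Rightarrow> real" where
  "set_realizations n S = (\<Sum>p\<in>S. realizations n p)"

definition nearest_integers :: "real ^ 'm \<Rightarrow> int ^ 'm \<Rightarrow> bool" where
  "nearest_integers x v \<longleftrightarrow>
     (\<forall>i. \<forall>k::int. \<bar>x $ i - real_of_int (v $ i)\<bar> \<le> \<bar>x $ i - real_of_int k\<bar>)"

(* A relation, because both the rounding of ties and the choice of the set A of adjusted
   entries are free. For d = 0 the set A is empty. *)
definition round_adjust :: "nat \<Rightarrow> real ^ 'm \<Rightarrow> int ^ 'm \<Rightarrow> bool" where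
  "round_adjust n \<phi> \<nu> \<longleftrightarrow>
     (\<exists>v d A. nearest_integers (real n *\<^sub>R \<phi>) v \<and>
        d = (\<Sum>i\<in>UNIV. v $ i) - int n \<and>
        int (card A) = \<bar>d\<bar> \<and>
        (d < 0 \<longrightarrow> A \<subseteq> {i. real_of_int (v $ i) < real n * \<phi> $ i}) \<and>
        (d > 0 \<longrightarrow> A \<subseteq> {i. real_of_int (v $ i) > real n * \<phi> $ i}) \<and>
        \<nu> = (\<chi> i. if i \<in> A then v $ i - sgn d else v $ i))"

definition rounded_distribution :: "nat \<Rightarrow> real ^ 'm \<Rightarrow> real ^ 'm \<Rightarrow> bool" where
  "rounded_distribution n \<phi> p \<longleftrightarrow>
     (\<exists>\<nu>. round_adjust n \<phi> \<nu> \<and> p = (\<chi> i. real_of_int (\<nu> $ i) / real n))"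

lemma nearest_integersD:
  assumes "nearest_integers x v"
  shows "\<bar>x $ i - real_of_int (v $ i)\<bar> \<le> 1/2"
proof -
  have "\<bar>x $ i - real_of_int (v $ i)\<bar> \<le> \<bar>x $ i - real_of_int (round (x $ i))\<bar>"
    using assms unfolding nearest_integers_def by blast
  then show ?thesis using of_int_round_abs_le[of "x $ i"] by linarith
qed

lemma rounded_distribution_in_P:
  fixes \<phi> p :: "real ^ 'm"
  assumes nn: "\<And>i. \<phi> $ i \<ge> 0" and r: "rounded_distribution n \<phi> p"
  shows "p \<in> P n"
proof -
  obtain \<nu> v d A where nr: "nearest_integers (real n *\<^sub>R \<phi>) v"
    and d: "d = (\<Sum>i\<in>UNIV. v $ i) - int n" and A: "int (card A) = \<bar>d\<bar>"
    and up: "d > 0 \<longrightarrow> A \<subseteq> {i. real_of_int (v $ i) > real n * \<phi> $ i}"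
    and \<nu>: "\<nu> = (\<chi> i. if i \<in> A then v $ i - sgn d else v $ i)"
    and p: "p = (\<chi> i. real_of_int (\<nu> $ i) / real n)"
    using r unfolding rounded_distribution_def round_adjust_def by blast
  have v0: "v $ i \<ge> 0" for i
  proof -
    have "real n * \<phi> $ i \<ge> 0" using nn by simp
    moreover have "\<bar>real n * \<phi> $ i - real_of_int (v $ i)\<bar> \<le> 1/2"
      using nearest_integersD[OF nr, of i] by simp
    ultimately have "real_of_int (v $ i) > -1" by linarith
    then show ?thesis by simp
  qed
  have n0: "\<nu> $ i \<ge> 0" for i
  proof (cases "i \<in> A \<and> d > 0")
    case True
    then have "real_of_int (v $ i) > real n * \<phi> $ i" using up by auto
    moreover have "real n * \<phi> $ i \<ge> 0" using nn by simp
    ultimately have "real_of_int (v $ i) > 0" by linarith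
    then show ?thesis using True \<nu> by simp
  next
    case False
    then show ?thesis using \<nu> v0[of i] by (auto simp: sgn_if)
  qed
  have "(\<Sum>i\<in>UNIV. \<nu> $ i) = (\<Sum>i\<in>UNIV. v $ i - (if i \<in> A then sgn d else 0))"
    unfolding \<nu> by (intro sum.cong) auto
  also have "\<dots> = (\<Sum>i\<in>UNIV. v $ i) - int (card A) * sgn d"
    by (simp add: sum_subtractf sum.If_cases)
  also have "\<dots> = int n" using A d by (simp add: abs_mult_sgn)
  finally have s: "(\<Sum>i\<in>UNIV. \<nu> $ i) = int n" .
  have "(\<Sum>i\<in>UNIV. nat (\<nu> $ i)) = n"
    using s n0 by (metis (no_types, lifting) int_nat_eq of_nat_eq_iff of_nat_sum sum.cong)
  moreover have "p = (\<chi> i. real ((\<chi> i. nat (\<nu> $ i)) $ i) / real n)"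
    unfolding p using n0 by (simp add: vec_eq_iff)
  ultimately show ?thesis unfolding P_def by (auto intro!: exI[of _ "\<chi> i. nat (\<nu> $ i)"])
qed

lemma rounded_distribution_exists:
  fixes \<phi> :: "real ^ 'm"
  assumes s1: "(\<Sum>i\<in>UNIV. \<phi> $ i) = 1"
  shows "\<exists>p. rounded_distribution n \<phi> p"
proof -
  define v :: "int ^ 'm" where "v = (\<chi> i. round (real n * \<phi> $ i))"
  define d where "d = (\<Sum>i\<in>UNIV. v $ i) - int n"
  define D where "D = {i. real_of_int (v $ i) < real n * \<phi> $ i}"
  define U where "U = {i. real_of_int (v $ i) > real n * \<phi> $ i}"
  have nr: "nearest_integers (real n *\<^sub>R \<phi>) v"
    unfolding nearest_integers_def v_def using round_diff_minimal by auto
  have b: "\<bar>real n * \<phi> $ i - real_of_int (v $ i)\<bar> \<le> 1/2" for i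
    using nearest_integersD[OF nr, of i] by simp
  have rd: "real_of_int d = (\<Sum>i\<in>UNIV. real_of_int (v $ i) - real n * \<phi> $ i)"
    using s1 by (simp add: d_def sum_subtractf flip: sum_distrib_left)
  have "real_of_int d \<le> (\<Sum>i\<in>UNIV. if i \<in> U then 1 else 0)"
    unfolding rd
  proof (intro sum_mono)
    fix i show "real_of_int (v $ i) - real n * \<phi> $ i \<le> (if i \<in> U then 1 else 0)"
      using b[of i] by (auto simp: U_def abs_le_iff simp del: divide_le_eq_numeral1 le_divide_eq_numeral1)
  qed
  then have dU: "real_of_int d \<le> card U" by (simp add: sum.If_cases)
  have "- real_of_int d = (\<Sum>i\<in>UNIV. real n * \<phi> $ i - real_of_int (v $ i))"
    unfolding rd by (simp add: sum_subtractf)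
  also have "\<dots> \<le> (\<Sum>i\<in>UNIV. if i \<in> D then 1 else 0)"
  proof (intro sum_mono)
    fix i show "real n * \<phi> $ i - real_of_int (v $ i) \<le> (if i \<in> D then 1 else 0)"
      using b[of i] by (auto simp: D_def abs_le_iff simp del: divide_le_eq_numeral1 le_divide_eq_numeral1)
  qed
  finally have dD: "- real_of_int d \<le> card D" by (simp add: sum.If_cases)
  have "\<exists>A. int (card A) = \<bar>d\<bar> \<and> (d < 0 \<longrightarrow> A \<subseteq> D) \<and> (d > 0 \<longrightarrow> A \<subseteq> U)"
  proof (cases "d < 0")
    case True
    then have "nat \<bar>d\<bar> \<le> card D" using dD by linarith
    then obtain A where "A \<subseteq> D" "card A = nat \<bar>d\<bar>" by (meson obtain_subset_with_card_n)
    then show ?thesis using True by (intro exI[of _ A]) auto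
  next
    case False
    then have "nat \<bar>d\<bar> \<le> card U" using dU by linarith
    then obtain A where "A \<subseteq> U" "card A = nat \<bar>d\<bar>" by (meson obtain_subset_with_card_n)
    then show ?thesis using False by (intro exI[of _ A]) auto
  qed
  then obtain A where "int (card A) = \<bar>d\<bar>" "d < 0 \<longrightarrow> A \<subseteq> D" "d > 0 \<longrightarrow> A \<subseteq> U" by blast
  then have "round_adjust n \<phi> (\<chi> i. if i \<in> A then v $ i - sgn d else v $ i)"
    unfolding round_adjust_def using nr d_def D_def U_def by blast
  then show ?thesis unfolding rounded_distribution_def by blast
qed

definition psi :: "nat \<Rightarrow> real \<Rightarrow> real \<Rightarrow> real" where
  "psi m \<alpha> \<theta> = 1/2 * \<theta>\<^sup>2 - \<alpha> * \<theta> * ln (real m / (\<alpha> * \<theta>))"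

definition C1 :: "nat \<Rightarrow> real \<Rightarrow> real \<Rightarrow> real" where
  "C1 m \<theta> \<alpha> = (real m - 1) / psi m \<alpha> \<theta>"

definition C2 :: "nat \<Rightarrow> real \<Rightarrow> real \<Rightarrow> real \<Rightarrow> real" where
  "C2 m \<epsilon> \<theta> \<alpha> =
     (real m * ln 0.6 + (0.5 * ln (2 * pi) + 1/12 - 0.5 * ln (real m)) * real m
        + ln ((1 / \<epsilon> + 1) / 0.249)) / psi m \<alpha> \<theta>"

(* Meaningful only if psi m \<alpha> \<theta> > 0 and not both C2 > 0 and C1 + C2 < 21. *)
definition N :: "nat \<Rightarrow> real \<Rightarrow> real \<Rightarrow> real \<Rightarrow> real" where
  "N m \<epsilon> \<theta> \<alpha> =
     (if C2 m \<epsilon> \<theta> \<alpha> > 0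
      then 1.5 * C1 m \<theta> \<alpha> * ln (C1 m \<theta> \<alpha> + C2 m \<epsilon> \<theta> \<alpha>) + C2 m \<epsilon> \<theta> \<alpha>
      else 1.5 * C1 m \<theta> \<alpha> * ln (C1 m \<theta> \<alpha>) + C2 m \<epsilon> \<theta> \<alpha>)"

end

(* The realizations of P_n are the m^n words of length n over m letters, and u* is the most
   likely type because balanced exponents minimise the product of factorials. As P_n has at most
   (n+1)^(m-1) elements, #u* >= m^n / (n+1)^(m-1). On the other side, an L1 distance above theta
   forces some set of letters to be overrepresented by more than theta/2, and Chernoff's method
   with Hoeffding's lemma and a union bound over the 2^m sets gives at most
   2^m m^n exp(-n theta^2/2) realizations. With beta = alpha theta, n >= N yields
   n psi >= (m-1) (ln n - 1) + C_2 psi, and n beta >= 3m/4 makes the term n beta ln(m/beta)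
   of n theta^2/2 absorb what remains. This avoids Stirling's formula and entropy estimates. *)

theory Submission
  imports Defs "HOL-Probability.Hoeffding"
begin

section \<open>Weak compositions and the multinomial theorem\<close>

text \<open>Forcing the value 0 outside \<open>A\<close> makes a function determined by its values
  on \<open>A\<close>, so that these sets are finite and a new index is added by a function
  update.\<close>

definition weak_compositions :: "'a set \<Rightarrow> nat \<Rightarrow> ('a \<Rightarrow> nat) set" where
  "weak_compositions A n = {\<nu>. (\<forall>i. i \<notin> A \<longrightarrow> \<nu> i = 0) \<and> sum \<nu> A = n}"

text \<open>Splits off the value at \<open>a\<close>. The index \<open>k\<close> is the sum over the
  old set, not the value at \<open>a\<close>, to match the form of the binomial theorem used
  below.\<close>

lemma weak_compositions_insert:
  assumes "finite A" "a \<notin> A"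
  shows "bij_betw (\<lambda>(k, \<mu>). \<mu>(a := n - k)) (SIGMA k:{..n}. weak_compositions A k)
           (weak_compositions (insert a A) n)"
proof (rule bij_betwI[where g = "\<lambda>\<nu>. (sum \<nu> A, \<nu>(a := 0))"])
  have upd: "sum (\<mu>(a := c)) A = sum \<mu> A" for \<mu> :: "'a \<Rightarrow> nat" and c
    using assms by (intro sum.cong) auto
  show "(\<lambda>(k, \<mu>). \<mu>(a := n - k)) \<in> (SIGMA k:{..n}. weak_compositions A k)
          \<rightarrow> weak_compositions (insert a A) n"
    using assms by (auto simp: weak_compositions_def upd simp del: fun_upd_apply)
      (auto simp: fun_upd_apply)
  show "(\<lambda>\<nu>. (sum \<nu> A, \<nu>(a := 0))) \<in> weak_compositions (insert a A) n
          \<rightarrow> (SIGMA k:{..n}. weak_compositions A k)"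
    using assms by (auto simp: weak_compositions_def upd simp del: fun_upd_apply)
      (auto simp: fun_upd_apply)
  show "(sum ((case x of (k, \<mu>) \<Rightarrow> \<mu>(a := n - k))) A,
      (case x of (k, \<mu>) \<Rightarrow> \<mu>(a := n - k))(a := 0)) = x"
    if "x \<in> (SIGMA k:{..n}. weak_compositions A k)" for x
    using that assms by (auto simp: weak_compositions_def upd fun_upd_idem simp del: fun_upd_apply)
  show "(case (sum \<nu> A, \<nu>(a := 0)) of (k, \<mu>) \<Rightarrow> \<mu>(a := n - k)) = \<nu>"
    if "\<nu> \<in> weak_compositions (insert a A) n" for \<nu>
    using that assms by (auto simp: weak_compositions_def)
qed

lemma finite_weak_compositions:
  assumes "finite A"
  shows "finite (weak_compositions A n)"
  using assms
proof (induction A arbitrary: n)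
  case empty
  have "weak_compositions {} n \<subseteq> {\<lambda>_. 0}"
    by (auto simp: weak_compositions_def)
  then show ?case
    by (rule finite_subset) simp
next
  case (insert a A)
  then show ?case
    using bij_betw_finite[OF weak_compositions_insert[of A a n]] by auto
qed

theorem multinomial_theorem:
  fixes x :: "'a \<Rightarrow> real"
  assumes "finite A"
  shows "(\<Sum>\<nu>\<in>weak_compositions A n. fact n / (\<Prod>i\<in>A. fact (\<nu> i)) * (\<Prod>i\<in>A. x i ^ \<nu> i)) = sum x A ^ n"
proof -
  \<comment> \<open>Divided by \<open>fact n\<close>, the summand is a plain product over
    \<open>A\<close>: inserting an index contributes one factor, and the induction reduces to the
    binomial theorem.\<close>
  have "(\<Sum>\<nu>\<in>weak_compositions A n. \<Prod>i\<in>A. x i ^ \<nu> i / fact (\<nu> i)) = sum x A ^ n / fact n"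
    using assms
  proof (induction A arbitrary: n)
    case empty
    have "weak_compositions {} n = (if n = 0 then {\<lambda>_::'a. 0} else {})"
      by (auto simp: weak_compositions_def)
    then show ?case
      by simp
  next
    case (insert a A)
    let ?t = "\<lambda>A \<nu>. \<Prod>i\<in>A. x i ^ \<nu> i / fact (\<nu> i)"
    have upd: "?t (insert a A) (\<mu>(a := c)) = x a ^ c / fact c * ?t A \<mu>" for \<mu> c
    proof -
      have "?t A (\<mu>(a := c)) = ?t A \<mu>"
        using insert.hyps by (intro prod.cong) auto
      then show ?thesis
        using insert.hyps by simp
    qed
    have "(\<Sum>\<nu>\<in>weak_compositions (insert a A) n. ?t (insert a A) \<nu>)
        = (\<Sum>(k, \<mu>)\<in>(SIGMA k:{..n}. weak_compositions A k). ?t (insert a A) (\<mu>(a := n - k)))"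
      using insert.hyps
      by (subst sum.reindex_bij_betw[OF weak_compositions_insert, symmetric])
        (auto simp: case_prod_unfold)
    also have "\<dots> = (\<Sum>k\<le>n. \<Sum>\<mu>\<in>weak_compositions A k. x a ^ (n - k) / fact (n - k) * ?t A \<mu>)"
      unfolding upd using insert.hyps by (subst sum.Sigma) (auto simp: finite_weak_compositions)
    also have "\<dots> = (\<Sum>k\<le>n. x a ^ (n - k) / fact (n - k) * (sum x A ^ k / fact k))"
      by (simp only: insert.IH flip: sum_distrib_left)
    also have "\<dots> = (sum x A + x a) ^ n / fact n"
      unfolding binomial_ring sum_divide_distrib
      by (intro sum.cong) (auto simp: binomial_fact field_simps)
    finally show ?case
      using insert.hyps by (simp add: add.commute)
  qed
  then have "fact n * (\<Sum>\<nu>\<in>weak_compositions A n. \<Prod>i\<in>A. x i ^ \<nu> i / fact (\<nu> i)) = sum x A ^ n"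
    by simp
  then show ?thesis
    by (simp add: sum_distrib_left prod_dividef)
qed

text \<open>The total is fixed, so all values but one determine the composition, and each lies in
  \<open>{..n}\<close>.\<close>

lemma card_weak_compositions_le:
  fixes n :: nat
  shows "card (weak_compositions (UNIV :: 'm::finite set) n) \<le> (n + 1) ^ (CARD('m) - 1)"
proof -
  \<comment> \<open>\<open>undefined\<close> just picks some index, the one whose value is recovered
    from the total.\<close>
  define j :: 'm where "j = undefined"
  let ?A = "UNIV - {j}"
  have "inj_on (\<lambda>\<nu>. restrict \<nu> ?A) (weak_compositions UNIV n)"
  proof (rule inj_onI)
    fix \<nu> \<mu> :: "'m \<Rightarrow> nat"
    assume *: "\<nu> \<in> weak_compositions UNIV n" "\<mu> \<in> weak_compositions UNIV n"
      "restrict \<nu> ?A = restrict \<mu> ?A"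
    have eq: "\<nu> i = \<mu> i" if "i \<noteq> j" for i
      using fun_cong[OF *(3), of i] that by simp
    have "sum \<nu> ?A = sum \<mu> ?A"
      using eq by (intro sum.cong) auto
    moreover have "\<nu> j + sum \<nu> ?A = \<mu> j + sum \<mu> ?A"
      using *(1,2) by (simp add: weak_compositions_def flip: sum.remove)
    ultimately show "\<nu> = \<mu>"
      using eq by (metis add_right_cancel ext)
  qed
  moreover have "\<nu> i \<le> n" if "\<nu> \<in> weak_compositions UNIV n" for \<nu> and i :: 'm
    using that member_le_sum[of i UNIV \<nu>] by (simp add: weak_compositions_def)
  then have "(\<lambda>\<nu>. restrict \<nu> ?A) ` weak_compositions UNIV n \<subseteq> PiE ?A (\<lambda>_. {..n})"
    by (auto split: if_splits)
  ultimately have "card (weak_compositions (UNIV :: 'm set) n) \<le> card (PiE ?A (\<lambda>_. {..n}))"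
    by (intro card_inj_on_le[of "\<lambda>\<nu>. restrict \<nu> ?A"]) (auto intro: finite_PiE)
  then show ?thesis
    by (simp add: card_PiE)
qed

section \<open>The balanced multinomial coefficient is the largest\<close>

text \<open>Going up from \<open>q\<close>, each new factor is at least \<open>q + 1\<close>; going
  down, each factor removed is at most \<open>q + 1\<close>. This is a supporting line of the convex
  log-factorial, touching at \<open>q\<close> and \<open>q + 1\<close>; the real exponent covers
  both signs of \<open>k - q\<close>.\<close>

lemma fact_ge_fact_mult_powr:
  fixes q k :: nat
  shows "fact q * (real q + 1) powr (real k - real q) \<le> fact k"
proof (cases "q \<le> k")
  case True
  then show ?thesis
  proof (induction rule: dec_induct)
    case (step k)
    have "fact q * (real q + 1) powr (real (Suc k) - real q)
        = (real q + 1) * (fact q * (real q + 1) powr (real k - real q))"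
      using powr_add[of "real q + 1" 1 "real k - real q"] by (simp add: algebra_simps)
    also have "\<dots> \<le> (real k + 1) * fact k"
      using step by (intro mult_mono) auto
    finally show ?case
      by (simp add: algebra_simps)
  qed simp
next
  case False
  then have "k \<le> q"
    by simp
  then show ?thesis
  proof (induction rule: inc_induct)
    case (step k)
    have "fact q * (real q + 1) powr (real k - real q)
        = (fact q * (real q + 1) powr (real (Suc k) - real q)) / (real q + 1)"
      using powr_diff[of "real q + 1" "real (Suc k) - real q" 1] by (simp add: algebra_simps)
    also have "\<dots> \<le> fact (Suc k) / (real k + 1)"
      using step by (intro frac_le) auto
    also have "\<dots> = fact k"
      by (simp add: add.commute)
    finally show ?case .
  qed simp
qed

text \<open>The supporting line is exact at \<open>q\<close> and \<open>q + 1\<close>, and the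
  product of the lower bounds depends on the exponents only through their sum, which both families
  share.\<close>

lemma prod_fact_balanced_le:
  fixes \<nu> \<mu> :: "'a \<Rightarrow> nat"
  assumes "finite A" "\<And>i. i \<in> A \<Longrightarrow> \<nu> i = q \<or> \<nu> i = q + 1" "sum \<nu> A = sum \<mu> A"
  shows "(\<Prod>i\<in>A. fact (\<nu> i)) \<le> (\<Prod>i\<in>A. fact (\<mu> i) :: real)"
proof -
  have powr_sum': "(\<Prod>i\<in>A. fact q * (real q + 1) powr (real (f i) - real q))
      = fact q ^ card A * (real q + 1) powr (real (sum f A) - real (card A) * real q)" for f
    using powr_sum[of "real q + 1" "\<lambda>i. real (f i) - real q" A] assms(1)
    by (simp add: prod.distrib sum_subtractf)
  have "(\<Prod>i\<in>A. fact (\<nu> i) :: real) = (\<Prod>i\<in>A. fact q * (real q + 1) powr (real (\<nu> i) - real q))"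
    using assms(2) by (intro prod.cong) (fastforce simp: algebra_simps)+
  also have "\<dots> = (\<Prod>i\<in>A. fact q * (real q + 1) powr (real (\<mu> i) - real q))"
    by (simp only: powr_sum' assms(3))
  also have "\<dots> \<le> (\<Prod>i\<in>A. fact (\<mu> i))"
    by (intro prod_mono) (auto intro: fact_ge_fact_mult_powr)
  finally show ?thesis .
qed

text \<open>With all variables equal to 1 the coefficients add up to m^n; none exceeds the balanced
  one, and there are at most (n+1)^(m-1) of them.\<close>

lemma balanced_multinomial_ge:
  fixes \<nu> :: "'m::finite \<Rightarrow> nat"
  assumes "sum \<nu> UNIV = n" "\<And>i. \<nu> i = q \<or> \<nu> i = q + 1"
  shows "real CARD('m) ^ n \<le> real (n + 1) ^ (CARD('m) - 1) * (fact n / (\<Prod>i\<in>UNIV. fact (\<nu> i)))"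
proof -
  let ?W = "weak_compositions (UNIV :: 'm set) n"
  have "real CARD('m) ^ n = (\<Sum>\<mu>\<in>?W. fact n / (\<Prod>i\<in>UNIV. fact (\<mu> i)))"
    using multinomial_theorem[of "UNIV :: 'm set" n "\<lambda>_. 1"] by simp
  also have "\<dots> \<le> (\<Sum>\<mu>\<in>?W. fact n / (\<Prod>i\<in>UNIV. fact (\<nu> i)))"
    using assms by (intro sum_mono divide_left_mono prod_fact_balanced_le)
      (auto simp: weak_compositions_def intro!: mult_pos_pos prod_pos)
  also have "\<dots> = real (card ?W) * (fact n / (\<Prod>i\<in>UNIV. fact (\<nu> i)))"
    by simp
  also have "\<dots> \<le> real ((n + 1) ^ (CARD('m) - 1)) * (fact n / (\<Prod>i\<in>UNIV. fact (\<nu> i)))"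
    by (intro mult_right_mono of_nat_mono card_weak_compositions_le divide_nonneg_nonneg prod_nonneg) auto
  finally show ?thesis
    by simp
qed

section \<open>Chernoff bound for one set of letters\<close>

text \<open>Divided by m^n, the left side is the probability that among n uniform letters the share
  lying in \<open>A\<close> exceeds its mean by more than \<theta>/2. The multinomial theorem with
  weight \<open>exp h\<close> on the letters of \<open>A\<close> replaces the moment generating
  function.\<close>

lemma multinomial_tail_subset:
  fixes A :: "'m::finite set" and \<theta> :: real
  assumes "\<theta> \<ge> 0"
  shows "(\<Sum>\<nu> | \<nu> \<in> weak_compositions UNIV n
             \<and> real (sum \<nu> A) > real n * (real (card A) / real CARD('m) + \<theta> / 2).
           fact n / (\<Prod>i\<in>UNIV. fact (\<nu> i))) \<le> real CARD('m) ^ n * exp (- real n * \<theta>\<^sup>2 / 2)"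
    (is "sum ?c ?S \<le> _")
proof -
  define m where "m = real CARD('m)"
  define q where "q = real (card A) / m"
  \<comment> \<open>The minimiser of h^2/8 - h \<theta>/2, with minimum -\<theta>^2/2.\<close>
  define h where "h = 2 * \<theta>"
  define x where "x = (\<lambda>i. if i \<in> A then exp h else 1)"
  have m: "m > 0"
    by (simp add: m_def)
  have q: "q \<ge> 0"
    using m by (simp add: q_def)
  have c0: "?c \<nu> \<ge> 0" for \<nu> :: "'m \<Rightarrow> nat"
    by (intro divide_nonneg_nonneg prod_nonneg) auto
  have px: "(\<Prod>i\<in>UNIV. x i ^ \<nu> i) = exp (h * real (sum \<nu> A))" for \<nu>
  proof -
    have "(\<Prod>i\<in>UNIV. x i ^ \<nu> i) = (\<Prod>i\<in>UNIV. if i \<in> A then exp h ^ \<nu> i else 1)"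
      by (intro prod.cong) (auto simp: x_def)
    also have "\<dots> = (\<Prod>i\<in>A. exp h ^ \<nu> i)"
      by (simp add: prod.If_cases)
    also have "\<dots> = exp (h * real (sum \<nu> A))"
      by (simp add: exp_of_nat2_mult del: of_nat_sum flip: power_sum)
    finally show ?thesis .
  qed
  have sx: "sum x UNIV = m * (1 + q * (exp h - 1))"
  proof -
    have "sum x UNIV = (\<Sum>i\<in>UNIV. 1 + (if i \<in> A then exp h - 1 else 0))"
      by (intro sum.cong) (auto simp: x_def)
    also have "\<dots> = m + real (card A) * (exp h - 1)"
      by (simp add: sum.distrib sum.If_cases m_def)
    also have "\<dots> = m * (1 + q * (exp h - 1))"
      using m by (simp add: q_def field_simps)
    finally show ?thesis .
  qed
  have "1 + q * (exp h - 1) > 0"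
    using q assms by (intro add_pos_nonneg mult_nonneg_nonneg) (auto simp: h_def)
  \<comment> \<open>Hoeffding's lemma for an indicator variable of mean \<open>q\<close>.\<close>
  moreover have "ln (1 + q * (exp h - 1)) \<le> h * q + h\<^sup>2 / 8"
    using Hoeffdings_lemma_aux[of h q] q assms by (simp add: h_def)
  ultimately have mgf: "1 + q * (exp h - 1) \<le> exp (h * q + h\<^sup>2 / 8)"
    by (metis exp_le_cancel_iff exp_ln)
  \<comment> \<open>Markov's inequality: on the tail the inserted exponential factor is at least 1.
    Afterwards the sum is extended to all compositions, where it can be evaluated.\<close>
  have "sum ?c ?S \<le> (\<Sum>\<nu>\<in>?S. exp (- h * real n * (q + \<theta> / 2)) * (?c \<nu> * (\<Prod>i\<in>UNIV. x i ^ \<nu> i)))"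
  proof (intro sum_mono)
    fix \<nu> :: "'m \<Rightarrow> nat" assume "\<nu> \<in> ?S"
    then have "h * (real n * (q + \<theta> / 2)) \<le> h * real (sum \<nu> A)"
      using assms by (intro mult_left_mono) (auto simp: q_def m_def h_def)
    then have "1 \<le> exp (- h * real n * (q + \<theta> / 2)) * exp (h * real (sum \<nu> A))"
      by (simp flip: exp_add)
    from mult_left_mono[OF this c0[of \<nu>]]
    show "?c \<nu> \<le> exp (- h * real n * (q + \<theta> / 2)) * (?c \<nu> * (\<Prod>i\<in>UNIV. x i ^ \<nu> i))"
      unfolding px by (simp add: mult_ac)
  qed
  also have "\<dots> \<le> (\<Sum>\<nu>\<in>weak_compositions UNIV n.
      exp (- h * real n * (q + \<theta> / 2)) * (?c \<nu> * (\<Prod>i\<in>UNIV. x i ^ \<nu> i)))"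
    using c0 by (intro sum_mono2 mult_nonneg_nonneg prod_nonneg)
      (auto simp: finite_weak_compositions x_def)
  also have "\<dots> = exp (- h * real n * (q + \<theta> / 2)) * (m * (1 + q * (exp h - 1))) ^ n"
    by (simp only: multinomial_theorem[OF finite] sx flip: sum_distrib_left)
  also have "\<dots> \<le> exp (- h * real n * (q + \<theta> / 2)) * (m * exp (h * q + h\<^sup>2 / 8)) ^ n"
    using mgf m \<open>1 + q * (exp h - 1) > 0\<close> by (intro mult_left_mono power_mono) auto
  also have "\<dots> = m ^ n * exp (- h * real n * (q + \<theta> / 2) + real n * (h * q + h\<^sup>2 / 8))"
    by (simp only: power_mult_distrib exp_add exp_of_nat_mult mult_ac)
  also have "- h * real n * (q + \<theta> / 2) + real n * (h * q + h\<^sup>2 / 8) = - real n * \<theta>\<^sup>2 / 2"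
    by (simp add: h_def field_simps power2_eq_square)
  finally show ?thesis
    by (simp add: m_def)
qed

section \<open>Union bound for the distributions far from uniform\<close>

lemma sum_UNION_le:
  fixes f :: "'a \<Rightarrow> real"
  assumes "finite I" "\<And>i. i \<in> I \<Longrightarrow> finite (A i)" "\<And>x. f x \<ge> 0"
  shows "sum f (\<Union>i\<in>I. A i) \<le> (\<Sum>i\<in>I. sum f (A i))"
  using assms
proof (induction I)
  case (insert i I)
  have "sum f (A i \<union> (\<Union>i\<in>I. A i)) \<le> sum f (A i) + sum f (\<Union>i\<in>I. A i)"
    using insert.prems insert.hyps by (subst sum_Un) (auto intro: sum_nonneg)
  then show ?case
    using insert by fastforce
qed simp

text \<open>Positive and negative parts have equal mass, so the positive coordinates carry half of
  the norm.\<close>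

lemma half_norm1_eq_subset_sum:
  fixes x :: "real ^ 'm"
  assumes "(\<Sum>i\<in>UNIV. x $ i) = 0"
  shows "\<exists>A. (\<Sum>i\<in>A. x $ i) = norm1 x / 2"
proof
  let ?A = "{i. x $ i > 0}"
  have "norm1 x = (\<Sum>i\<in>UNIV. 2 * (if i \<in> ?A then x $ i else 0) - x $ i)"
    unfolding norm1_def by (intro sum.cong) auto
  also have "\<dots> = 2 * (\<Sum>i\<in>?A. x $ i)"
    using assms by (simp add: sum_subtractf sum.If_cases flip: sum_distrib_left)
  finally show "(\<Sum>i\<in>?A. x $ i) = norm1 x / 2"
    by simp
qed

text \<open>Exponents are plain functions here, so that the results on
  \<open>weak_compositions\<close> carry over to \<open>P n\<close>.\<close>

definition freq :: "nat \<Rightarrow> ('m \<Rightarrow> nat) \<Rightarrow> real ^ 'm" where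
  "freq n \<nu> = (\<chi> i. real (\<nu> i) / real n)"

lemma P_eq_freq_image: "P n = freq n ` weak_compositions (UNIV :: 'm::finite set) n"
proof (intro equalityI subsetI)
  fix p :: "real ^ 'm" assume "p \<in> P n"
  then obtain \<nu> :: "nat ^ 'm" where "p = (\<chi> i. real (\<nu> $ i) / real n)" "(\<Sum>i\<in>UNIV. \<nu> $ i) = n"
    unfolding P_def by auto
  then show "p \<in> freq n ` weak_compositions UNIV n"
    by (intro image_eqI[of _ _ "vec_nth \<nu>"]) (auto simp: freq_def weak_compositions_def)
next
  fix p :: "real ^ 'm" assume "p \<in> freq n ` weak_compositions UNIV n"
  then obtain \<nu> where "p = freq n \<nu>" "sum \<nu> UNIV = n"
    by (auto simp: weak_compositions_def)
  then show "p \<in> P n"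
    unfolding P_def freq_def by (auto intro!: exI[of _ "\<chi> i. \<nu> i"])
qed

lemma inj_freq: "n > 0 \<Longrightarrow> inj (freq n)"
  by (auto simp: inj_def freq_def vec_eq_iff)

lemma realizations_freq:
  "n > 0 \<Longrightarrow> realizations n (freq n \<nu>) = fact n / (\<Prod>i\<in>UNIV. fact (\<nu> i))"
  by (simp add: realizations_def freq_def)

text \<open>The deviation from uniform sums to 0, so an L1 distance above \<theta> gives some set of
  letters an excess above \<theta>/2. The factor 2^m counts the candidate sets.\<close>

lemma set_realizations_far_le:
  fixes \<theta> :: real
  assumes "n > 0" "\<theta> \<ge> 0"
  shows "set_realizations n {p \<in> P n. norm1 (p - (uniform :: real ^ 'm)) > \<theta>}
      \<le> 2 ^ CARD('m) * real CARD('m) ^ n * exp (- real n * \<theta>\<^sup>2 / 2)"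
proof -
  define S where "S = (\<lambda>A :: 'm set. {\<nu>. \<nu> \<in> weak_compositions UNIV n
             \<and> real (sum \<nu> A) > real n * (real (card A) / real CARD('m) + \<theta> / 2)})"
  let ?F = "{\<nu> \<in> weak_compositions UNIV n. norm1 (freq n \<nu> - (uniform :: real ^ 'm)) > \<theta>}"
  let ?c = "\<lambda>\<nu>. fact n / (\<Prod>i\<in>(UNIV :: 'm set). fact (\<nu> i)) :: real"
  have fin: "finite (S A)" for A
    by (rule finite_subset[OF _ finite_weak_compositions]) (auto simp: S_def)
  have F: "?F \<subseteq> (\<Union>A\<in>UNIV. S A)"
  proof
    fix \<nu> assume \<nu>: "\<nu> \<in> ?F"
    let ?x = "freq n \<nu> - (uniform :: real ^ 'm)"
    have "(\<Sum>i\<in>UNIV. ?x $ i) = real (sum \<nu> UNIV) / real n - 1"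
      by (simp add: freq_def uniform_def sum_subtractf sum_divide_distrib)
    then have "(\<Sum>i\<in>UNIV. ?x $ i) = 0"
      using \<nu> assms by (simp add: weak_compositions_def del: of_nat_sum)
    then obtain A where A: "(\<Sum>i\<in>A. ?x $ i) = norm1 ?x / 2"
      using half_norm1_eq_subset_sum by blast
    moreover have "(\<Sum>i\<in>A. ?x $ i) = real (sum \<nu> A) / real n - real (card A) / real CARD('m)"
      by (simp add: freq_def uniform_def sum_subtractf sum_divide_distrib)
    ultimately have "real (sum \<nu> A) / real n > real (card A) / real CARD('m) + \<theta> / 2"
      using \<nu> by (simp only: mem_Collect_eq) linarith
    then have "\<nu> \<in> S A"
      using \<nu> assms by (simp add: S_def field_simps)
    then show "\<nu> \<in> (\<Union>A\<in>UNIV. S A)"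
      by blast
  qed
  have "{p \<in> P n. norm1 (p - (uniform :: real ^ 'm)) > \<theta>} = freq n ` ?F"
    unfolding P_eq_freq_image by auto
  then have "set_realizations n {p \<in> P n. norm1 (p - (uniform :: real ^ 'm)) > \<theta>} = sum ?c ?F"
    unfolding set_realizations_def using assms
    by (simp add: sum.reindex inj_on_subset[OF inj_freq] realizations_freq)
  also have "\<dots> \<le> sum ?c (\<Union>A\<in>UNIV. S A)"
    using F fin by (intro sum_mono2) (auto intro!: divide_nonneg_nonneg prod_nonneg)
  also have "\<dots> \<le> (\<Sum>A\<in>UNIV. sum ?c (S A))"
    using fin by (intro sum_UNION_le) (auto intro!: divide_nonneg_nonneg prod_nonneg)
  also have "\<dots> \<le> (\<Sum>A\<in>(UNIV :: 'm set set). real CARD('m) ^ n * exp (- real n * \<theta>\<^sup>2 / 2))"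
    unfolding S_def using assms by (intro sum_mono multinomial_tail_subset)
  also have "\<dots> = 2 ^ CARD('m) * real CARD('m) ^ n * exp (- real n * \<theta>\<^sup>2 / 2)"
    by (simp add: card_UNIV_set)
  finally show ?thesis .
qed

section \<open>Shape and error of the rounded uniform distribution\<close>

text \<open>All entries equal n/m, so rounding gives the floor \<open>q\<close> or
  \<open>q + 1\<close>. Adjusting adds 1 only to entries rounded down, which are \<open>q\<close>,
  and subtracts 1 only from entries rounded up, which are \<open>q + 1\<close>.\<close>

lemma rounded_uniform_balanced:
  fixes u :: "real ^ 'm"
  assumes "n > 0" "rounded_distribution n uniform u"
  obtains \<nu> where "sum \<nu> UNIV = n" "u = freq n \<nu>"
    "\<And>i. \<nu> i = n div CARD('m) \<or> \<nu> i = n div CARD('m) + 1"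
proof -
  have "u \<in> P n"
    by (rule rounded_distribution_in_P[OF _ assms(2)]) (simp add: uniform_def)
  then obtain \<nu> where \<nu>: "sum \<nu> UNIV = n" "u = freq n \<nu>"
    by (auto simp: P_eq_freq_image weak_compositions_def)
  obtain \<mu> v d A where nr: "nearest_integers (real n *\<^sub>R (uniform :: real ^ 'm)) v"
    and down: "d < 0 \<longrightarrow> A \<subseteq> {i. real_of_int (v $ i) < real n * uniform $ i}"
    and up: "d > 0 \<longrightarrow> A \<subseteq> {i. real_of_int (v $ i) > real n * uniform $ i}"
    and \<mu>: "\<mu> = (\<chi> i. if i \<in> A then v $ i - sgn d else v $ i)"
    and u: "u = (\<chi> i. real_of_int (\<mu> $ i) / real n)"
    using assms(2) unfolding rounded_distribution_def round_adjust_def by blast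
  define q where "q = \<lfloor>real n / real CARD('m)\<rfloor>"
  have q: "real_of_int q \<le> real n / real CARD('m)" "real n / real CARD('m) < real_of_int q + 1"
    unfolding q_def by linarith+
  have "\<mu> $ i = q \<or> \<mu> $ i = q + 1" for i
  proof -
    have "\<bar>real n / real CARD('m) - real_of_int (v $ i)\<bar> \<le> 1/2"
      using nearest_integersD[OF nr, of i] by (simp add: uniform_def)
    then have v: "v $ i = q \<or> v $ i = q + 1"
      using q by linarith
    have "v $ i = q" if "i \<in> A" "d < 0"
      using v down that q by (auto simp: uniform_def)
    moreover have "v $ i = q + 1" if "i \<in> A" "d > 0"
      using v up that q by (auto simp: uniform_def)
    ultimately show ?thesis
      using v by (auto simp: \<mu> sgn_if)
  qed
  \<comment> \<open>The natural exponents from membership in \<open>P n\<close> and the integers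
    from the rounding describe the same \<open>u\<close>; the common denominator cancels.\<close>
  moreover have "\<mu> $ i = int (\<nu> i)" for i
  proof -
    have "u $ i = real_of_int (\<mu> $ i) / real n"
      by (simp add: u)
    moreover have "u $ i = real (\<nu> i) / real n"
      by (simp add: \<nu>(2) freq_def)
    ultimately have "real_of_int (\<mu> $ i) = real_of_int (int (\<nu> i))"
      using assms(1) by simp
    then show ?thesis
      by (simp only: of_int_eq_iff)
  qed
  moreover have "q = int (n div CARD('m))"
    unfolding q_def by (rule floor_divide_of_nat_eq)
  ultimately have "\<nu> i = n div CARD('m) \<or> \<nu> i = n div CARD('m) + 1" for i
    by (metis of_nat_1 of_nat_add of_nat_eq_iff)
  then show ?thesis
    using that \<nu> by blast
qed

text \<open>If a share f of the entries equals \<open>q + 1\<close>, the deviations add up to 2 m f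
  (1 - f) / n, which is largest at f = 1/2.\<close>

lemma norm1_balanced_le:
  fixes \<nu> :: "'m::finite \<Rightarrow> nat"
  assumes "n > 0" "sum \<nu> UNIV = n" "\<And>i. \<nu> i = q \<or> \<nu> i = q + 1"
  shows "norm1 (freq n \<nu> - (uniform :: real ^ 'm)) \<le> real CARD('m) / (2 * real n)"
proof -
  define m where "m = real CARD('m)"
  define f where "f = real n / m - real q"
  define t where "t = (\<lambda>i. real (\<nu> i) - real q)"
  have m: "m > 0"
    by (simp add: m_def)
  have t: "t i = 0 \<or> t i = 1" for i
    using assms(3)[of i] by (auto simp: t_def)
  have "(\<Sum>i\<in>UNIV. t i) = real (sum \<nu> UNIV) - m * real q"
    by (simp add: t_def sum_subtractf m_def)
  also have "\<dots> = m * f"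
    using m assms(2) by (simp add: f_def field_simps)
  finally have st: "sum t UNIV = m * f" .
  have f0: "0 \<le> f"
  proof -
    have "0 \<le> sum t UNIV"
      using t by (intro sum_nonneg) (metis order_refl zero_le_one)
    then show ?thesis
      using m st by (simp add: zero_le_mult_iff)
  qed
  have f1: "f \<le> 1"
  proof -
    have "sum t UNIV \<le> (\<Sum>i\<in>(UNIV :: 'm set). 1)"
      using t by (intro sum_mono) (metis order_refl zero_le_one)
    then show ?thesis
      using m st by (simp add: m_def)
  qed
  have "real n * norm1 (freq n \<nu> - (uniform :: real ^ 'm)) = (\<Sum>i\<in>UNIV. \<bar>t i - f\<bar>)"
    unfolding norm1_def sum_distrib_left
  proof (intro sum.cong refl)
    fix i
    have "real n * ((freq n \<nu> - (uniform :: real ^ 'm)) $ i) = t i - f"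
      using assms(1) m by (simp add: freq_def uniform_def t_def f_def m_def field_simps)
    then show "real n * \<bar>(freq n \<nu> - (uniform :: real ^ 'm)) $ i\<bar> = \<bar>t i - f\<bar>"
      by (metis abs_mult abs_of_nat)
  qed
  \<comment> \<open>For \<open>t i\<close> in {0, 1} and \<open>f\<close> in [0, 1] the absolute
    value is affine in \<open>t i\<close>, so only the sum of the \<open>t i\<close>
    matters.\<close>
  also have "\<dots> = (\<Sum>i\<in>UNIV. f + (1 - 2 * f) * t i)"
  proof (intro sum.cong refl)
    show "\<bar>t i - f\<bar> = f + (1 - 2 * f) * t i" for i
      using t[of i] f0 f1 by auto
  qed
  also have "\<dots> = m / 2 - 2 * m * (f - 1 / 2)\<^sup>2"
    by (simp add: sum.distrib st flip: sum_distrib_left)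
      (simp add: m_def power2_eq_square field_simps)
  also have "\<dots> \<le> m / 2"
    using m by simp
  finally show ?thesis
    using assms(1) by (simp add: m_def field_simps)
qed

section \<open>Inverting the inequality behind \<open>N\<close>\<close>

text \<open>The proof bounds \<open>ln x\<close> by the tangent of \<open>ln\<close> at \<open>C powr 1.5\<close>.\<close>

lemma linear_log_inversion:
  fixes c\<^sub>1 c\<^sub>2 C x :: real
  assumes "0 \<le> c\<^sub>1" "c\<^sub>1 \<le> C" "1 \<le> C"
    and "1.5 * c\<^sub>1 * ln C + c\<^sub>2 \<le> 1.5 * C * ln C"
    and "1.5 * c\<^sub>1 * ln C + c\<^sub>2 \<le> x" "0 < x"
  shows "c\<^sub>1 * (ln x - 1) + c\<^sub>2 \<le> x"
proof -
  define s where "s = sqrt C"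
  \<comment> \<open>\<open>a\<close> is C^1.5, the point of tangency; the exponent is the source of
    the factor 1.5 in \<open>N\<close>.\<close>
  define a where "a = s ^ 3"
  have s: "s \<ge> 1" "C = s\<^sup>2"
    using assms by (auto simp: s_def)
  have lnC: "ln C = 2 * ln s"
    using s by (simp add: ln_realpow)
  have a: "a > 0" "a = C * s"
    using s by (auto simp: a_def power2_eq_square power3_eq_cube)
  have lna: "ln a = 1.5 * ln C"
    using s by (simp add: a_def ln_realpow lnC)
  have "C * 1 \<le> C * s"
    using s(1) assms(3) by (intro mult_left_mono) auto
  then have ca: "c\<^sub>1 \<le> a"
    using assms(2) a(2) by simp
  define M where "M = 1.5 * c\<^sub>1 * ln C + c\<^sub>2"
  \<comment> \<open>Leads to \<open>1.5 * C * ln C \<le> 1.5 * a\<close>, hence to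
    \<open>M \<le> 2 * a\<close>.\<close>
  have "ln (s / 2) \<le> s / 2 - 1"
    using s by (intro ln_le_minus_one) auto
  then have "ln s \<le> s / 2"
    using s ln_2_less_1 by (simp add: ln_div)
  then have "1.5 * C * ln C \<le> C * (1.5 * s)"
    unfolding lnC using assms(3) by simp
  then have M: "M \<le> 2 * a"
    using assms(4) a by (simp add: M_def)
  have "ln (x / a) \<le> x / a - 1"
    using a assms(6) by (intro ln_le_minus_one) auto
  then have "ln x \<le> 1.5 * ln C + x / a - 1"
    using a(1) assms(6) by (simp add: ln_div lna)
  then have "c\<^sub>1 * (ln x - 1) \<le> c\<^sub>1 * (1.5 * ln C + x / a - 2)"
    using assms(1) by (intro mult_left_mono) auto
  then have 1: "c\<^sub>1 * (ln x - 1) + c\<^sub>2 \<le> M - 2 * c\<^sub>1 + (c\<^sub>1 / a) * x"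
    by (simp add: M_def algebra_simps)
  \<comment> \<open>It remains to see
    \<open>M - 2 * c\<^sub>1 \<le> (1 - c\<^sub>1 / a) * x\<close>. The right side is increasing in
    \<open>x\<close>, and at \<open>x = M\<close> the claim reads
    \<open>M \<le> 2 * a\<close>.\<close>
  have 2: "(1 - c\<^sub>1 / a) * M \<le> (1 - c\<^sub>1 / a) * x"
    using assms(5) ca a by (intro mult_left_mono) (auto simp: M_def)
  have 3: "(c\<^sub>1 / a) * M \<le> (c\<^sub>1 / a) * (2 * a)"
    using M assms(1) a by (intro mult_left_mono) auto
  have "(c\<^sub>1 / a) * (2 * a) = 2 * c\<^sub>1"
    using a(1) by simp
  then show ?thesis
    using 1 2 3 by (simp only: left_diff_distrib)
qed

text \<open>The two branches of \<open>N\<close> are the inversion with C = C1 + C2 and with C =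
  C1.\<close>

lemma N_lower_bound:
  assumes "m \<ge> 1" "psi m \<alpha> \<theta> > 0" "N m \<epsilon> \<theta> \<alpha> > 0"
    and "C2 m \<epsilon> \<theta> \<alpha> > 0 \<longrightarrow> C1 m \<theta> \<alpha> + C2 m \<epsilon> \<theta> \<alpha> \<ge> 21"
    and "x \<ge> N m \<epsilon> \<theta> \<alpha>"
  shows "C1 m \<theta> \<alpha> * (ln x - 1) + C2 m \<epsilon> \<theta> \<alpha> \<le> x"
proof -
  let ?c1 = "C1 m \<theta> \<alpha>" and ?c2 = "C2 m \<epsilon> \<theta> \<alpha>"
  have c1: "?c1 \<ge> 0"
    using assms(1,2) by (simp add: C1_def)
  have x: "x > 0"
    using assms by simp
  show ?thesis
  proof (cases "?c2 > 0")
    case True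
    then have C: "?c1 + ?c2 \<ge> 21"
      using assms(4) by simp
    \<comment> \<open>The bound 21 makes the logarithm at least 1, so that C2 is at most 1.5 C2 ln
      (C1 + C2).\<close>
    have "exp 1 \<le> (21::real)"
      using exp_le by linarith
    then have "1 \<le> ln (?c1 + ?c2)"
      using C by (subst ln_ge_iff) auto
    then have "?c2 * 1 \<le> ?c2 * (1.5 * ln (?c1 + ?c2))"
      using True by (intro mult_left_mono) auto
    then show ?thesis
      using True C c1 x assms(5)
      by (intro linear_log_inversion[of _ "?c1 + ?c2"]) (auto simp: N_def algebra_simps)
  next
    case False
    then have N: "N m \<epsilon> \<theta> \<alpha> = 1.5 * ?c1 * ln ?c1 + ?c2"
      by (simp add: N_def)
    \<comment> \<open>For C1 below 1 both summands of \<open>N\<close> would be nonpositive.\<close>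
    have "?c1 \<ge> 1"
    proof (rule ccontr)
      assume "\<not> ?c1 \<ge> 1"
      then have "?c1 * ln ?c1 \<le> 0"
        using c1 by (cases "?c1 = 0") (auto intro!: mult_nonneg_nonpos)
      then show False
        using N False assms(3) by simp
    qed
    then show ?thesis
      using False c1 x assms(5) N by (intro linear_log_inversion[of _ ?c1]) auto
  qed
qed

section \<open>Comparison of the exponents\<close>

text \<open>The left side collects the 2^m of the union bound and the polynomial loss of the lower
  bound. In logarithms, n \<theta>^2/2 splits into n psi, bounded through
  \<open>N_lower_bound\<close>, and n b ln (m/b), bounded through the equation for \<alpha>.\<close>

lemma exponent_dominates:
  fixes \<epsilon> \<theta> \<alpha> :: real
  assumes "m \<ge> 1" "\<epsilon> > 0" "0 < \<theta>" "\<theta> \<le> 0.09" "0 < \<alpha>" "\<alpha> < 1"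
    and psi: "psi m \<alpha> \<theta> > 0"
    and large: "C2 m \<epsilon> \<theta> \<alpha> > 0 \<longrightarrow> C1 m \<theta> \<alpha> + C2 m \<epsilon> \<theta> \<alpha> \<ge> 21"
    and N: "N m \<epsilon> \<theta> \<alpha> = 3 * real m / (4 * \<alpha> * \<theta>)"
    and n: "real n \<ge> N m \<epsilon> \<theta> \<alpha>"
  shows "2 ^ m * real (n + 1) ^ (m - 1) < \<epsilon> * exp (real n * \<theta>\<^sup>2 / 2)"
proof -
  define b where "b = \<alpha> * \<theta>"
  have b0: "b > 0"
    using assms by (simp add: b_def)
  have "b < 1 * \<theta>"
    unfolding b_def using assms by (intro mult_strict_right_mono) auto
  then have b: "b < 9 / 100" "b < \<theta>"
    using assms by auto
  have m: "real m \<ge> 1"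
    using assms by simp
  have nb: "real n * b \<ge> 3 / 4 * real m"
    using n N b0 by (simp add: b_def field_simps)
  have "N m \<epsilon> \<theta> \<alpha> > 0"
    using N m b0 by (simp add: b_def)
  then have n0: "real n > 0"
    using n by linarith
  \<comment> \<open>4/3 times 0.09 is 0.12, below 1/8.\<close>
  have n8: "real m \<le> real n / 8"
  proof -
    have "real n * b \<le> real n * (9 / 100)"
      using b by (intro mult_left_mono) auto
    then show ?thesis
      using nb n0 by linarith
  qed
  have "C1 m \<theta> \<alpha> * (ln n - 1) + C2 m \<epsilon> \<theta> \<alpha> \<le> real n"
    by (rule N_lower_bound) (use assms \<open>N m \<epsilon> \<theta> \<alpha> > 0\<close> in auto)
  then have "(C1 m \<theta> \<alpha> * (ln n - 1) + C2 m \<epsilon> \<theta> \<alpha>) * psi m \<alpha> \<theta> \<le> real n * psi m \<alpha> \<theta>"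
    using psi by (intro mult_right_mono) auto
  moreover have "C1 m \<theta> \<alpha> * psi m \<alpha> \<theta> = real m - 1"
    using psi by (simp add: C1_def)
  moreover define K where "K = real m * ln 0.6 + (0.5 * ln (2 * pi) + 1/12 - 0.5 * ln m) * real m
      + ln ((1 / \<epsilon> + 1) / 0.249)"
  moreover have "C2 m \<epsilon> \<theta> \<alpha> * psi m \<alpha> \<theta> = K"
  proof -
    have "C2 m \<epsilon> \<theta> \<alpha> = K / psi m \<alpha> \<theta>"
      by (simp only: C2_def K_def)
    then show ?thesis
      using psi by simp
  qed
  ultimately have key: "(real m - 1) * (ln n - 1) + K \<le> real n * psi m \<alpha> \<theta>"
    by (simp only: distrib_right mult.assoc mult.left_commute[of _ "psi m \<alpha> \<theta>"])
      (simp add: algebra_simps)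
  \<comment> \<open>Here \<theta> \<le> 0.09 enters: 1/b exceeds 9, which exceeds e^2.\<close>
  have lnb: "ln (real m / b) \<ge> ln m + 2"
  proof -
    have "exp (1 + 1) \<le> (3::real) * 3"
      unfolding exp_add using exp_le by (intro mult_mono) auto
    also have "\<dots> \<le> 1 / b"
      using b b0 by (simp add: field_simps)
    finally have "2 \<le> ln (1 / b)"
      using b0 by (subst ln_ge_iff) auto
    then show ?thesis
      using b0 m by (simp add: ln_div)
  qed
  have "real n * psi m \<alpha> \<theta> = real n * \<theta>\<^sup>2 / 2 - real n * b * ln (real m / b)"
    by (simp add: psi_def b_def algebra_simps)
  moreover have "3 / 4 * real m * (ln m + 2) \<le> real n * b * ln (real m / b)"
    by (rule mult_mono[OF nb lnb]) (use m b0 in auto)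
  ultimately have A: "3 / 4 * real m * (ln m + 2) + (real m - 1) * (ln n - 1)
      + real m * ln 0.6 + (0.5 * ln (2 * pi) + 1/12 - 0.5 * ln m) * real m
      + ln ((1 / \<epsilon> + 1) / 0.249) \<le> real n * \<theta>\<^sup>2 / 2"
    using key unfolding K_def by linarith
  have E: "ln (1 / \<epsilon>) < ln ((1 / \<epsilon> + 1) / 0.249)"
    using assms(2) by (subst ln_less_cancel_iff) (auto simp: field_simps)
  \<comment> \<open>Exchanging ln n for ln (n + 1) costs at most (m - 1)/n.\<close>
  have L: "(real m - 1) * ln (real n + 1) \<le> (real m - 1) * ln n + 1 / 8"
  proof -
    have "ln (1 + 1 / real n) \<le> 1 / real n"
      using n0 by (intro ln_add_one_self_le_self) auto
    moreover have "ln (1 + 1 / real n) = ln (real n + 1) - ln n"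
    proof -
      have "1 + 1 / real n = (real n + 1) / real n"
        using n0 by (simp add: field_simps)
      then show ?thesis
        using n0 by (simp add: ln_div)
    qed
    ultimately have "(real m - 1) * ln (real n + 1) \<le> (real m - 1) * (ln n + 1 / real n)"
      using m by (intro mult_left_mono) auto
    moreover have "(real m - 1) * (1 / real n) \<le> 1 / 8"
      using n8 n0 m by (simp add: field_simps)
    ultimately show ?thesis
      unfolding distrib_left by linarith
  qed
  \<comment> \<open>Doubled and with 2 pi replaced by 6, this asks that ln (4 / (0.36 * 6)) = ln (1
    / 0.54) be at most 1 + 1/6.\<close>
  have num: "ln 2 \<le> 0.5 + ln 0.6 + 0.5 * ln (2 * pi) + 1/12"
  proof -
    have "ln (6::real) \<le> ln (2 * pi)"
      using pi_gt3 by (subst ln_le_cancel_iff) auto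
    moreover have "ln (1 / 0.54 :: real) \<le> 1 / 0.54 - 1"
      by (intro ln_le_minus_one) auto
    moreover have "ln (1 / 0.54 :: real) = 2 * ln 2 - 2 * ln 0.6 - ln 6"
    proof -
      have "ln (a\<^sup>2 / (c\<^sup>2 * e)) = 2 * ln a - 2 * ln c - ln e"
        if "a > 0" "c > 0" "e > 0" for a c e :: real
        using that by (simp add: ln_div ln_mult ln_realpow)
      from this[of 2 "0.6" 6] show ?thesis
        by (simp add: power2_eq_square)
    qed
    ultimately show ?thesis
      by (simp del: ln_le_cancel_iff)
  qed
  define l where "l = ln (real m)"
  have "real m * ln 2 \<le> real m * (0.5 + ln 0.6 + 0.5 * ln (2 * pi) + 1/12)"
    using num m by (intro mult_left_mono) auto
  moreover have "real m * l \<ge> 0"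
    using m by (simp add: l_def)
  \<comment> \<open>In \<open>A\<close> the terms m ln m have coefficient 3/4 - 1/2, which is
    positive. Of the 3m/2 from \<open>lnb\<close>, m - 1 is spent on the -1 beside ln n; the
    remaining m/2 goes into \<open>num\<close>, and the extra 1 covers the 1/8 of
    \<open>L\<close>.\<close>
  ultimately have "real m * ln 2 + (real m - 1) * ln (real n + 1) + ln (1 / \<epsilon>) < real n * \<theta>\<^sup>2 / 2"
    using A[folded l_def] E L m by (simp add: algebra_simps add_divide_distrib del: ln_less_cancel_iff)
  moreover have "ln (2 ^ m * real (n + 1) ^ (m - 1) / \<epsilon>)
      = real m * ln 2 + (real m - 1) * ln (real n + 1) + ln (1 / \<epsilon>)"
    using assms(1,2) by (simp add: ln_div ln_mult ln_realpow of_nat_diff add.commute)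
  moreover have "2 ^ m * real (n + 1) ^ (m - 1) / \<epsilon> > 0"
    using assms(2) by simp
  ultimately have "2 ^ m * real (n + 1) ^ (m - 1) / \<epsilon> < exp (real n * \<theta>\<^sup>2 / 2)"
    by (metis exp_less_cancel_iff exp_ln)
  then show ?thesis
    using assms(2) by (simp add: field_simps)
qed

section \<open>Combining the lower bound, the tail bound and the comparison of exponents\<close>

theorem corollary3p2:
  fixes \<epsilon> \<theta> \<alpha> :: real and n :: nat and u :: "real ^ 'm"
  assumes "\<epsilon> > 0"
    and "0 < \<theta>" and "\<theta> \<le> min 0.09 (1 / real CARD('m))"
    and "0 < \<alpha>" and "\<alpha> < 1"
    and "psi CARD('m) \<alpha> \<theta> > 0"
    and "C2 CARD('m) \<epsilon> \<theta> \<alpha> > 0 \<longrightarrow> C1 CARD('m) \<theta> \<alpha> + C2 CARD('m) \<epsilon> \<theta> \<alpha> \<ge> 21"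
    and "N CARD('m) \<epsilon> \<theta> \<alpha> = 3 * real CARD('m) / (4 * \<alpha> * \<theta>)"
    and "real n \<ge> N CARD('m) \<epsilon> \<theta> \<alpha>"
    and "rounded_distribution n uniform u"
  shows "\<epsilon> * realizations n u
           > set_realizations n {p \<in> P n. norm1 (p - (uniform :: real ^ 'm)) > \<theta>}
         \<and> norm1 (u - uniform) \<le> \<alpha> * \<theta>"
proof -
  let ?m = "CARD('m)"
  let ?D = "real (n + 1) ^ (?m - 1)"
  have "0 < 3 * real ?m / (4 * \<alpha> * \<theta>)"
    using assms by simp
  then have n: "n > 0"
    using assms(8,9) by (cases n) auto
  obtain \<nu> where \<nu>: "sum \<nu> UNIV = n" "u = freq n \<nu>"
    "\<And>i. \<nu> i = n div ?m \<or> \<nu> i = n div ?m + 1"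
    using rounded_uniform_balanced[OF n assms(10)] by blast
  have real_u: "realizations n u = fact n / (\<Prod>i\<in>UNIV. fact (\<nu> i))"
    using n by (simp add: \<nu>(2) realizations_freq)
  have dom: "2 ^ ?m * ?D < \<epsilon> * exp (real n * \<theta>\<^sup>2 / 2)"
    by (rule exponent_dominates[where \<alpha> = \<alpha>]) (use assms in auto)
  have D: "?D > 0"
    by simp
  let ?S = "set_realizations n {p \<in> P n. norm1 (p - (uniform :: real ^ 'm)) > \<theta>}"
  \<comment> \<open>Both sides carry the factor \<open>?D\<close>, cancelled only at the end, so
    that the lower bound on \<open>realizations n u\<close> applies without a division.\<close>
  have "?D * ?S \<le> ?D * (2 ^ ?m * real ?m ^ n * exp (- real n * \<theta>\<^sup>2 / 2))"
    using n assms(2) by (intro mult_left_mono set_realizations_far_le) auto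
  also have "\<dots> = (2 ^ ?m * ?D) * (real ?m ^ n * exp (- real n * \<theta>\<^sup>2 / 2))"
    by (simp add: mult_ac)
  also have "\<dots> < (\<epsilon> * exp (real n * \<theta>\<^sup>2 / 2)) * (real ?m ^ n * exp (- real n * \<theta>\<^sup>2 / 2))"
    using dom by (intro mult_strict_right_mono) auto
  also have "\<dots> = \<epsilon> * real ?m ^ n"
    by (simp add: exp_minus)
  also have "\<dots> \<le> \<epsilon> * (?D * realizations n u)"
    unfolding real_u using assms(1) \<nu> by (intro mult_left_mono balanced_multinomial_ge) auto
  also have "\<dots> = ?D * (\<epsilon> * realizations n u)"
    by (simp add: mult_ac)
  finally have "?S < \<epsilon> * realizations n u"
    using D by (simp only: mult_less_cancel_left_pos)
  moreover have "norm1 (u - uniform) \<le> \<alpha> * \<theta>"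
  proof -
    have "norm1 (u - uniform) \<le> real ?m / (2 * real n)"
      unfolding \<nu>(2) using n \<nu>(1,3) by (rule norm1_balanced_le)
    also have "\<dots> \<le> \<alpha> * \<theta>"
    proof -
      \<comment> \<open>This is n \<ge> N with denominators cleared; it makes m/(2n) at most two
        thirds of \<alpha>\<theta>.\<close>
      have "3 * real ?m \<le> 4 * (\<alpha> * \<theta>) * real n"
        using assms(2,4) assms(9)[unfolded assms(8)] by (simp add: field_simps)
      then have "real ?m \<le> 2 * (\<alpha> * \<theta>) * real n"
        by simp
      then show ?thesis
        using n by (simp add: field_simps)
    qed
    finally show ?thesis .
  qed
  ultimately show ?thesis
    by simp
qed

end
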